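(* Let $G$ be a countable infinite discrete amenable group acting continuously on a compact metric space $(X,d)$, and let $\{F_n\}_{n=1}^{\infty}$ be a Følner sequence in $G$ with $|F_n|$ increasing and $|F_n|\to\infty$. Let $\Phi:X\to\mathbb{R}$ be a positive continuous function and $\mu\in M(X)$. Then $$\dim_{\mu}^{\widetilde{BS}}(\{F_n\}_{n=1}^{\infty},\Phi)=\dim_{\mu}^{\widetilde{K}}(\{F_n\}_{n=1}^{\infty},\Phi)=\inf\left\{\dim_H^{\widetilde{BS}}(\{F_n\}_{n=1}^{\infty},\Phi):H\subset X \text{ Borel},\ \mu(H)=1\right\}.$$
   Context: A Følner sequence in $G$ is a sequence of non-empty finite subsets $F_n\subset G$ with $\lim_{n\to\infty}|F_n\triangle gF_n|/|F_n|=0$ for every $g\in G$. $M(X)$ is the set of Borel probability measures on $X$. For finite $F\subset G$: $d_F(x,y)=\max_{g\in F}d(gx,gy)$, $B_F(x,\epsilon)=\{y\in X:d_F(x,y)<\epsilon\}$, and $\Phi_F(x)=\sum_{g\in F}\Phi(gx)$. All quantities take values in $[0,\infty]$; in critical values below $s$ ranges over $s>0$, with $\sup\emptyset=0$, $\inf\emptyset=\infty$. BS dimension of a set. For non-empty $H\subset X$, $\epsilon>0$, $N\in\mathbb{N}$, $s>0$ let $$M^{s}_{N,\epsilon}(H,\{F_n\},\Phi)=\inf\sum_{i\in I}\exp\Big[-s\sup_{y\in B_{F_{n_i}}(x_i,\epsilon)}\Phi_{F_{n_i}}(y)\Big],$$ the infimum over all finite or countable covers $\{B_{F_{n_i}}(x_i,\epsilon)\}_{i\in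 I}$ of $H$ with $n_i\ge N$, $x_i\in X$. Let $M^s_\epsilon(H,\{F_n\},\Phi)=\lim_{N\to\infty}M^s_{N,\epsilon}(H,\{F_n\},\Phi)$, $M_\epsilon(H,\{F_n\},\Phi)=\inf\{s:M^s_\epsilon=0\}=\sup\{s:M^s_\epsilon=\infty\}$, and $\dim_H^{\widetilde{BS}}(\{F_n\},\Phi)=\lim_{\epsilon\to0}M_\epsilon(H,\{F_n\},\Phi)$. Let $\widetilde M^s_{N,\epsilon}$, $\widetilde M^s_\epsilon$, $\widetilde M_\epsilon$ be defined in the same way with $\sup_{y\in B_{F_{n_i}}(x_i,\epsilon)}\Phi_{F_{n_i}}(y)$ replaced by $\Phi_{F_{n_i}}(x_i)$. BS dimension of $\mu$: $\dim_{\mu}^{\widetilde{BS}}(\{F_n\},\Phi)=\lim_{\epsilon\to0}\lim_{\delta\to0}\inf\{\widetilde M_\epsilon(H,\{F_n\},\Phi):H\subset X\text{ Borel},\ \mu(H)\ge1-\delta\}$. BS dimension of $\mu$ in the sense of Katok: for $\delta\in(0,1)$ let $$\Lambda^s_{N,\epsilon}(\mu,\{F_n\},\Phi,\delta)=\inf\sum_{i\in I}\exp[-s\Phi_{F_{n_i}}(x_i)],$$ the infimum over all finite or countable families $\{B_{F_{n_i}}(x_i,\epsilon)\}_{i\in I}$ with $n_i\ge N$, $x_i\in X$ and $\mu(\bigcup_{i\in I}B_{F_{n_i}}(x_i,\epsilon))>1-\delta$; let $\Lambda^s_\epsilon=\lim_{N\to\infty}\Lambda^s_{N,\epsilon}$,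 $\Lambda_\epsilon(\mu,\{F_n\},\Phi,\delta)=\inf\{s:\Lambda^s_\epsilon=0\}=\sup\{s:\Lambda^s_\epsilon=\infty\}$, and $\dim_\mu^{\widetilde K}(\{F_n\},\Phi)=\lim_{\epsilon\to0}\lim_{\delta\to0}\Lambda_\epsilon(\mu,\{F_n\},\Phi,\delta)$. *)

theory Defs
  imports "HOL-Probability.Probability" "HOL-Algebra.Group_Action" "HOL-Algebra.Coset"
begin

definition folner_sequence :: "('g, 'm) monoid_scheme \<Rightarrow> (nat \<Rightarrow> 'g set) \<Rightarrow> bool" where
  "folner_sequence G F \<longleftrightarrow>
     (\<forall>n. finite (F n) \<and> F n \<noteq> {} \<and> F n \<subseteq> carrier G) \<and>
     (\<forall>g\<in>carrier G.
        (\<lambda>n. real (card (sym_diff (F n) (g <#\<^bsub>G\<^esub> F n))) / real (card (F n))) \<longlonglongrightarrow> 0)"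

text \<open>For a countable discrete group, amenability is the existence of a Folner sequence.\<close>

definition amenable_group :: "('g, 'm) monoid_scheme \<Rightarrow> bool" where
  "amenable_group G \<longleftrightarrow> group G \<and> (\<exists>F. folner_sequence G F)"

definition bowen_dist :: "('g \<Rightarrow> 'x::metric_space \<Rightarrow> 'x) \<Rightarrow> 'g set \<Rightarrow> 'x \<Rightarrow> 'x \<Rightarrow> real" where
  "bowen_dist act A x y = Max ((\<lambda>g. dist (act g x) (act g y)) ` A)"

definition bowen_ball :: "('g \<Rightarrow> 'x::metric_space \<Rightarrow> 'x) \<Rightarrow> 'g set \<Rightarrow> 'x \<Rightarrow> real \<Rightarrow> 'x set" where
  "bowen_ball act A x \<epsilon> = {y. bowen_dist act A x y < \<epsilon>}"

definition orbit_sum :: "('g \<Rightarrow> 'x \<Rightarrow> 'x) \<Rightarrow> ('x \<Rightarrow> real) \<Rightarrow> 'g set \<Rightarrow> 'x \<Rightarrow> real" where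
  "orbit_sum act \<Phi> A x = (\<Sum>g\<in>A. \<Phi> (act g x))"

text \<open>
  A finite or countable family of Bowen balls is encoded as a triple \<open>(I, n, x)\<close>, indexed by an
  arbitrary set \<open>I\<close> of naturals; its members are the balls around \<open>x i\<close> for the set \<open>F (n i)\<close>,
  where \<open>i \<in> I\<close>. Values of \<open>n\<close> and \<open>x\<close> outside \<open>I\<close> are irrelevant.
\<close>

type_synonym 'x ball_family = "nat set \<times> (nat \<Rightarrow> nat) \<times> (nat \<Rightarrow> 'x)"

definition families_from :: "nat \<Rightarrow> 'x ball_family set" where
  "families_from N = {(I, n, x). \<forall>i\<in>I. N \<le> n i}"

definition family_union ::
  "('g \<Rightarrow> 'x::metric_space \<Rightarrow> 'x) \<Rightarrow> (nat \<Rightarrow> 'g set) \<Rightarrow> real \<Rightarrow> 'x ball_family \<Rightarrow> 'x set" where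
  "family_union act F \<epsilon> = (\<lambda>(I, n, x). \<Union>i\<in>I. bowen_ball act (F (n i)) (x i) \<epsilon>)"

text \<open>
  The supremum is taken in the reals; it is a genuine one for continuous \<open>\<Phi>\<close> on a compact space
  and \<open>\<epsilon> > 0\<close>, where the ball contains its centre and orbit sums are bounded.
\<close>

definition sup_weight ::
  "('g \<Rightarrow> 'x::metric_space \<Rightarrow> 'x) \<Rightarrow> (nat \<Rightarrow> 'g set) \<Rightarrow> ('x \<Rightarrow> real) \<Rightarrow> real \<Rightarrow> real \<Rightarrow>
     'x ball_family \<Rightarrow> ennreal" where
  "sup_weight act F \<Phi> \<epsilon> s = (\<lambda>(I, n, x). \<Sum>\<^sub>\<infinity>i\<in>I.
     ennreal (exp (- s * (SUP y\<in>bowen_ball act (F (n i)) (x i) \<epsilon>. orbit_sum act \<Phi> (F (n i)) y))))"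

definition centre_weight ::
  "('g \<Rightarrow> 'x \<Rightarrow> 'x) \<Rightarrow> (nat \<Rightarrow> 'g set) \<Rightarrow> ('x \<Rightarrow> real) \<Rightarrow> real \<Rightarrow> 'x ball_family \<Rightarrow> ennreal" where
  "centre_weight act F \<Phi> s = (\<lambda>(I, n, x). \<Sum>\<^sub>\<infinity>i\<in>I.
     ennreal (exp (- s * orbit_sum act \<Phi> (F (n i)) (x i))))"

text \<open>
  In \<^typ>\<open>ennreal\<close> the infimum of the empty set is \<open>\<infinity>\<close>. When \<open>\<Phi>\<close> is bounded below by a positive
  constant and \<open>card (F n)\<close> tends to infinity, the value below is also the supremum of the
  \<open>s > 0\<close> at which the outer measure is \<open>\<infinity>\<close>.
\<close>

definition critical_value :: "(real \<Rightarrow> ennreal) \<Rightarrow> ennreal" where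
  "critical_value m = Inf {ennreal s | s. 0 < s \<and> m s = 0}"

definition M_pre ::
  "('g \<Rightarrow> 'x::metric_space \<Rightarrow> 'x) \<Rightarrow> (nat \<Rightarrow> 'g set) \<Rightarrow> ('x \<Rightarrow> real) \<Rightarrow> real \<Rightarrow> 'x set \<Rightarrow>
     real \<Rightarrow> nat \<Rightarrow> ennreal" where
  "M_pre act F \<Phi> \<epsilon> H s N =
     (INF c\<in>{c \<in> families_from N. H \<subseteq> family_union act F \<epsilon> c}. sup_weight act F \<Phi> \<epsilon> s c)"

definition M_crit ::
  "('g \<Rightarrow> 'x::metric_space \<Rightarrow> 'x) \<Rightarrow> (nat \<Rightarrow> 'g set) \<Rightarrow> ('x \<Rightarrow> real) \<Rightarrow> real \<Rightarrow> 'x set \<Rightarrow> ennreal" where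
  "M_crit act F \<Phi> \<epsilon> H = critical_value (\<lambda>s. lim (M_pre act F \<Phi> \<epsilon> H s))"

definition BS_dim_set ::
  "('g \<Rightarrow> 'x::metric_space \<Rightarrow> 'x) \<Rightarrow> (nat \<Rightarrow> 'g set) \<Rightarrow> ('x \<Rightarrow> real) \<Rightarrow> 'x set \<Rightarrow> ennreal" where
  "BS_dim_set act F \<Phi> H = Lim (at_right 0) (\<lambda>\<epsilon>. M_crit act F \<Phi> \<epsilon> H)"

definition Mt_pre ::
  "('g \<Rightarrow> 'x::metric_space \<Rightarrow> 'x) \<Rightarrow> (nat \<Rightarrow> 'g set) \<Rightarrow> ('x \<Rightarrow> real) \<Rightarrow> real \<Rightarrow> 'x set \<Rightarrow>
     real \<Rightarrow> nat \<Rightarrow> ennreal" where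
  "Mt_pre act F \<Phi> \<epsilon> H s N =
     (INF c\<in>{c \<in> families_from N. H \<subseteq> family_union act F \<epsilon> c}. centre_weight act F \<Phi> s c)"

definition Mt_crit ::
  "('g \<Rightarrow> 'x::metric_space \<Rightarrow> 'x) \<Rightarrow> (nat \<Rightarrow> 'g set) \<Rightarrow> ('x \<Rightarrow> real) \<Rightarrow> real \<Rightarrow> 'x set \<Rightarrow> ennreal" where
  "Mt_crit act F \<Phi> \<epsilon> H = critical_value (\<lambda>s. lim (Mt_pre act F \<Phi> \<epsilon> H s))"

definition BS_dim_measure ::
  "('g \<Rightarrow> 'x::metric_space \<Rightarrow> 'x) \<Rightarrow> (nat \<Rightarrow> 'g set) \<Rightarrow> ('x \<Rightarrow> real) \<Rightarrow> 'x measure \<Rightarrow> ennreal" where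
  "BS_dim_measure act F \<Phi> \<mu> =
     Lim (at_right 0) (\<lambda>\<epsilon>. Lim (at_right 0) (\<lambda>\<delta>.
       INF H\<in>{H \<in> sets borel. measure \<mu> H \<ge> 1 - \<delta>}. Mt_crit act F \<Phi> \<epsilon> H))"

definition Katok_pre ::
  "('g \<Rightarrow> 'x::metric_space \<Rightarrow> 'x) \<Rightarrow> (nat \<Rightarrow> 'g set) \<Rightarrow> ('x \<Rightarrow> real) \<Rightarrow> 'x measure \<Rightarrow> real \<Rightarrow> real \<Rightarrow>
     real \<Rightarrow> nat \<Rightarrow> ennreal" where
  "Katok_pre act F \<Phi> \<mu> \<epsilon> \<delta> s N =
     (INF c\<in>{c \<in> families_from N. measure \<mu> (family_union act F \<epsilon> c) > 1 - \<delta>}.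
        centre_weight act F \<Phi> s c)"

definition Katok_crit ::
  "('g \<Rightarrow> 'x::metric_space \<Rightarrow> 'x) \<Rightarrow> (nat \<Rightarrow> 'g set) \<Rightarrow> ('x \<Rightarrow> real) \<Rightarrow> 'x measure \<Rightarrow> real \<Rightarrow> real \<Rightarrow>
     ennreal" where
  "Katok_crit act F \<Phi> \<mu> \<epsilon> \<delta> = critical_value (\<lambda>s. lim (Katok_pre act F \<Phi> \<mu> \<epsilon> \<delta> s))"

definition Katok_dim_measure ::
  "('g \<Rightarrow> 'x::metric_space \<Rightarrow> 'x) \<Rightarrow> (nat \<Rightarrow> 'g set) \<Rightarrow> ('x \<Rightarrow> real) \<Rightarrow> 'x measure \<Rightarrow> ennreal" where
  "Katok_dim_measure act F \<Phi> \<mu> =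
     Lim (at_right 0) (\<lambda>\<epsilon>. Lim (at_right 0) (\<lambda>\<delta>. Katok_crit act F \<Phi> \<mu> \<epsilon> \<delta>))"

end

theory Submission
  imports Defs
begin

text \<open>
  Every quantity involved is monotone: shrinking the radius \<open>\<epsilon>\<close> or the defect \<open>\<delta>\<close>, or raising
  the starting index \<open>N\<close>, leaves fewer admissible families. So all limits are suprema, and an outer
  measure vanishes in the limit \<open>N \<rightarrow> \<infinity>\<close> exactly when it vanishes for every \<open>N\<close>. Write
  \<open>K \<epsilon>\<close> and \<open>A \<epsilon>\<close> for the suprema over \<open>\<delta>\<close> of the Katok critical value and of the infimum of
  the critical values (with centre weights) of Borel sets of measure at least \<open>1 - \<delta>\<close>.

  The proof rests on three comparisons.

  First, a cover of a set of measure more than \<open>1 - \<delta>\<close> is a Katok family, so the Katok critical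
  value is at most the critical value of the set (\<open>Katok_crit_le_Mt_crit\<close>). Hence \<open>K \<epsilon> \<le> A \<epsilon>\<close>,
  and \<open>K \<epsilon>\<close> is a lower bound for the critical values of sets of full measure.

  Second, this lower bound is approached by sets of full measure (\<open>full_measure_set\<close>). If
  \<open>s > K \<epsilon>\<close>, then for every \<open>\<delta>\<close> and \<open>N\<close> there are Katok families of arbitrarily small weight;
  countably many of them, with defects tending to \<open>0\<close> and summable weights, merge into one family
  of small weight whose union has full measure. The intersection of such unions over all \<open>N\<close> and
  over weights tending to \<open>0\<close> is covered by each of these families, so its critical value is at
  most \<open>s\<close>. This gives \<open>A \<epsilon> \<le> K \<epsilon>\<close>, which is the first equality. Intersecting the sets obtained
  for a sequence of radii tending to \<open>0\<close> yields one set of full measure that serves all radii,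
  which lets the infimum over sets be exchanged with the limit in \<open>\<epsilon>\<close>.

  Third, the dimension of a set may be computed with centre weights instead of suprema over balls
  (\<open>BS_dim_set_eq_SUP_Mt_crit\<close>). The potential is uniformly continuous and bounded below by a
  positive constant, so on small Bowen balls orbit sums vary by a factor as close to \<open>1\<close> as
  desired; changing the weight then costs only an arbitrarily small change of the exponent \<open>s\<close>.
\<close>

section \<open>Limits of monotone families and critical values\<close>

lemma Lim_at_right_antimono_eq_SUP:
  fixes f :: "real \<Rightarrow> 'b::{complete_linorder, linorder_topology}"
  assumes "\<And>a b. 0 < a \<Longrightarrow> a \<le> b \<Longrightarrow> f b \<le> f a"
  shows "Lim (at_right 0) f = (SUP a\<in>{0<..}. f a)"
proof (rule tendsto_Lim)
  show "(f \<longlongrightarrow> (SUP a\<in>{0<..}. f a)) (at_right 0)"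
  proof (rule order_tendstoI)
    fix u assume "u < (SUP a\<in>{0<..}. f a)"
    then obtain a where a: "0 < a" "u < f a"
      by (auto simp: less_SUP_iff)
    have near: "\<forall>\<^sub>F b in at_right 0. b \<in> {0<..<a}"
      using a(1) by (rule eventually_at_right_real)
    have less: "u < f b" if "b \<in> {0<..<a}" for b
    proof -
      have "f a \<le> f b"
        using that by (intro assms) auto
      with a(2) show ?thesis
        by (rule less_le_trans)
    qed
    show "\<forall>\<^sub>F b in at_right 0. u < f b"
      by (rule eventually_mono[OF near less])
  next
    fix u assume u: "(SUP a\<in>{0<..}. f a) < u"
    have near: "\<forall>\<^sub>F b::real in at_right 0. 0 < b"
      by (rule eventually_at_right_less)
    have less: "f b < u" if "0 < b" for b
    proof -
      have "f b \<le> (SUP a\<in>{0<..}. f a)"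
        using that by (intro SUP_upper) simp
      then show ?thesis
        using u by (rule le_less_trans)
    qed
    show "\<forall>\<^sub>F b in at_right 0. f b < u"
      by (rule eventually_mono[OF near less])
  qed
qed simp

lemma SUP_positive_cofinal:
  fixes f :: "real \<Rightarrow> 'b::complete_lattice"
  assumes "\<And>a b. 0 < a \<Longrightarrow> a \<le> b \<Longrightarrow> f b \<le> f a"
    and "\<And>k::nat. f (1 / (real k + 1)) \<le> u"
  shows "(SUP a\<in>{0<..}. f a) \<le> u"
proof (rule SUP_least)
  fix a :: real assume "a \<in> {0<..}"
  then obtain k where k: "inverse (real (Suc k)) < a"
    using reals_Archimedean by auto
  have "f a \<le> f (1 / (real k + 1))"
    using k by (intro assms(1)) (auto simp: field_simps)
  then show "f a \<le> u"
    using assms(2) order_trans by blast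
qed

text \<open>
  A critical value is an infimum of real exponents, so upper bounds are most easily tested on the
  reals lying strictly above the claimed bound.
\<close>

lemma ennreal_le_if_le_reals_above:
  assumes "\<And>s. b < ennreal s \<Longrightarrow> a \<le> ennreal s"
  shows "a \<le> b"
proof (rule dense_ge)
  fix z assume "b < z"
  then show "a \<le> z"
    using assms by (cases z) auto
qed

lemma incseq_lim_eq_0_iff:
  fixes X :: "nat \<Rightarrow> ennreal"
  assumes "incseq X"
  shows "lim X = 0 \<longleftrightarrow> (\<forall>N. X N = 0)"
proof -
  have "lim X = (SUP N. X N)"
    using LIMSEQ_SUP[OF assms] by (rule limI)
  then show ?thesis
    by (auto simp: bot_ennreal[symmetric])
qed

lemma critical_value_lim_le:
  assumes "incseq (Y s)" "0 < s" "\<And>N. Y s N = 0"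
  shows "critical_value (\<lambda>s. lim (Y s)) \<le> ennreal s"
  unfolding critical_value_def
  using assms incseq_lim_eq_0_iff[of "Y s"] by (intro Inf_lower) auto

text \<open>
  Weights decrease in the exponent, so once an outer measure vanishes at one exponent it vanishes
  at all larger ones.
\<close>

lemma zero_above_critical_value_lim:
  assumes "\<And>s. incseq (Y s)"
    and "\<And>s t N. s \<le> t \<Longrightarrow> Y t N \<le> Y s N"
    and "critical_value (\<lambda>s. lim (Y s)) < ennreal s"
  shows "Y s N = 0"
proof -
  obtain t where t: "0 < t" "ennreal t < ennreal s" "lim (Y t) = 0"
    using assms(3) by (auto simp: critical_value_def Inf_less_iff)
  then have "Y t N = 0"
    using assms(1) incseq_lim_eq_0_iff by blast
  moreover have "t \<le> s"
    using t(1,2) by (simp add: ennreal_less_iff)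
  ultimately show ?thesis
    using assms(2)[of t s N] by simp
qed

lemma critical_value_lim_mono:
  assumes "\<And>s. incseq (Y s)" "\<And>s. incseq (Z s)"
    and "\<And>s N. 0 < s \<Longrightarrow> Y s N \<le> Z s N"
  shows "critical_value (\<lambda>s. lim (Y s)) \<le> critical_value (\<lambda>s. lim (Z s))"
  unfolding critical_value_def
proof (rule Inf_superset_mono, safe)
  fix s :: real assume s: "0 < s" "lim (Z s) = 0"
  then have "\<forall>N. Y s N = 0"
    using assms incseq_lim_eq_0_iff[of "Z s"] by (metis le_zero_eq)
  then show "\<exists>t. ennreal s = ennreal t \<and> 0 < t \<and> lim (Y t) = 0"
    using s(1) assms(1) incseq_lim_eq_0_iff by blast
qed

section \<open>Families of Bowen balls\<close>

lemma infsum_mono_ennreal: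
  fixes f g :: "'i \<Rightarrow> ennreal"
  assumes "\<And>i. i \<in> A \<Longrightarrow> f i \<le> g i"
  shows "infsum f A \<le> infsum g A"
proof (rule infsum_mono)
  show "f summable_on A" "g summable_on A"
    by (rule nonneg_summable_on_complete, simp)+
qed (rule assms)

lemma bowen_ball_mono: "\<epsilon> \<le> \<epsilon>' \<Longrightarrow> bowen_ball act A x \<epsilon> \<subseteq> bowen_ball act A x \<epsilon>'"
  by (auto simp: bowen_ball_def)

lemma family_union_mono:
  assumes "\<epsilon> \<le> \<epsilon>'"
  shows "family_union act F \<epsilon> c \<subseteq> family_union act F \<epsilon>' c"
  by (cases c) (simp add: family_union_def UN_mono bowen_ball_mono[OF assms])

lemma incseq_INF_families_from:
  fixes w :: "'x ball_family \<Rightarrow> 'b::complete_lattice"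
  shows "incseq (\<lambda>N. INF c\<in>{c \<in> families_from N. P c}. w c)"
proof (rule incseq_SucI)
  fix N
  have "families_from (Suc N) \<subseteq> (families_from N :: 'x ball_family set)"
    by (auto simp: families_from_def)
  then have "{c \<in> families_from (Suc N). P c} \<subseteq> {c \<in> families_from N. P c}"
    by blast
  then show "(INF c\<in>{c \<in> families_from N. P c}. w c)
    \<le> (INF c\<in>{c \<in> families_from (Suc N). P c}. w c)"
    by (rule INF_superset_mono) simp
qed

lemma incseq_pre:
  "incseq (M_pre act F \<Phi> \<epsilon> H s)"
  "incseq (Mt_pre act F \<Phi> \<epsilon> H s)"
  "incseq (Katok_pre act F \<Phi> \<mu> \<epsilon> \<delta> s)"
  unfolding M_pre_def[abs_def] Mt_pre_def[abs_def] Katok_pre_def[abs_def]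
  by (rule incseq_INF_families_from)+

text \<open>
  The pairing bijection of \<open>nat \<times> nat\<close> with \<open>nat\<close> indexes the disjoint union of countably many
  families by naturals again. The total weight is bounded through its finite partial sums, each of
  which splits along the first coordinate.
\<close>

lemma combine_ball_families:
  fixes cs :: "nat \<Rightarrow> 'x::metric_space ball_family"
  assumes "\<And>j. cs j \<in> families_from N"
  obtains c where "c \<in> families_from N"
    and "family_union act F \<epsilon> c = (\<Union>j. family_union act F \<epsilon> (cs j))"
    and "centre_weight act F \<Phi> s c \<le> (\<Sum>j. centre_weight act F \<Phi> s (cs j))"
proof -
  define I where "I j = fst (cs j)" for j
  define n where "n j = fst (snd (cs j))" for j
  define x where "x j = snd (snd (cs j))" for j
  have cs: "cs j = (I j, n j, x j)" for j
    unfolding I_def n_def x_def by simp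
  define h where "h j i = ennreal (exp (- s * orbit_sum act \<Phi> (F (n j i)) (x j i)))" for j i
  let ?L = "prod_encode ` (SIGMA j:UNIV. I j)"
  let ?c = "(?L, \<lambda>k. case_prod n (prod_decode k), \<lambda>k. case_prod x (prod_decode k))"
  have "\<forall>i\<in>I j. N \<le> n j i" for j
    using assms[of j] by (simp add: families_from_def cs)
  then have c_from: "?c \<in> families_from N"
    by (auto simp: families_from_def)
  have flatten: "(\<Union>p\<in>Sigma UNIV I. f (fst p) (snd p)) = (\<Union>j. \<Union>i\<in>I j. f j i)"
    for f :: "nat \<Rightarrow> nat \<Rightarrow> 'x set"
    by force
  have c_union: "family_union act F \<epsilon> ?c = (\<Union>j. family_union act F \<epsilon> (cs j))"
    by (simp add: family_union_def cs split_beta)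
      (rule flatten[of "\<lambda>j i. bowen_ball act (F (n j i)) (x j i) \<epsilon>"])
  have "centre_weight act F \<Phi> s ?c = infsum (\<lambda>k. case_prod h (prod_decode k)) ?L"
    by (simp add: centre_weight_def h_def case_prod_beta)
  also have "\<dots> = infsum (case_prod h) (SIGMA j:UNIV. I j)"
    by (subst infsum_reindex) (auto simp: inj_prod_encode o_def)
  also have "\<dots> = (SUP K\<in>{K. finite K \<and> K \<subseteq> (SIGMA j:UNIV. I j)}. sum (case_prod h) K)"
    by (rule nonneg_infsum_complete) simp
  also have "\<dots> \<le> (\<Sum>j. centre_weight act F \<Phi> s (cs j))"
  proof (rule SUP_least, safe)
    fix K assume K: "finite K" "K \<subseteq> (SIGMA j:UNIV. I j)"
    have "{i. (j, i) \<in> K} \<subseteq> snd ` K" for j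
      by force
    then have fin: "finite {i. (j, i) \<in> K}" for j
      using K(1) finite_imageI finite_subset by metis
    have "K = (SIGMA j:fst ` K. {i. (j, i) \<in> K})"
      by force
    then have "sum (case_prod h) K = sum (case_prod h) (SIGMA j:fst ` K. {i. (j, i) \<in> K})"
      by (rule arg_cong)
    also have "\<dots> = (\<Sum>j\<in>fst ` K. \<Sum>i\<in>{i. (j, i) \<in> K}. h j i)"
      using K(1) fin by (simp add: sum.Sigma)
    also have "\<dots> \<le> (\<Sum>j\<in>fst ` K. centre_weight act F \<Phi> s (cs j))"
    proof (rule sum_mono)
      fix j
      have "(\<Sum>i\<in>{i. (j, i) \<in> K}. h j i) = infsum (h j) {i. (j, i) \<in> K}"
        using fin by simp
      also have "\<dots> \<le> infsum (h j) (I j)"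
        using K(2) by (intro infsum_mono_neutral nonneg_summable_on_complete) auto
      also have "\<dots> = centre_weight act F \<Phi> s (cs j)"
        by (simp add: centre_weight_def cs h_def[abs_def])
      finally show "(\<Sum>i\<in>{i. (j, i) \<in> K}. h j i) \<le> centre_weight act F \<Phi> s (cs j)" .
    qed
    also have "\<dots> \<le> (\<Sum>j. centre_weight act F \<Phi> s (cs j))"
      using K(1) by (intro sum_le_suminf) auto
    finally show "sum (case_prod h) K \<le> (\<Sum>j. centre_weight act F \<Phi> s (cs j))" .
  qed
  finally show ?thesis
    using c_from c_union that by blast
qed

section \<open>Weights of positive continuous potentials\<close>

locale positive_potential =
  fixes act :: "'g \<Rightarrow> 'x::metric_space \<Rightarrow> 'x"
    and F :: "nat \<Rightarrow> 'g set"
    and \<Phi> :: "'x \<Rightarrow> real"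
  assumes compact_space: "compact (UNIV :: 'x set)"
    and finite_F: "\<And>n. finite (F n)"
    and F_nonempty: "\<And>n. F n \<noteq> {}"
    and continuous_act: "\<And>n g. g \<in> F n \<Longrightarrow> continuous_on UNIV (act g)"
    and continuous_potential: "continuous_on UNIV \<Phi>"
    and potential_pos: "\<And>x. 0 < \<Phi> x"
begin

lemma mem_bowen_ball_iff:
  "y \<in> bowen_ball act (F n) x \<epsilon> \<longleftrightarrow> (\<forall>g\<in>F n. dist (act g x) (act g y) < \<epsilon>)"
  using finite_F[of n] F_nonempty[of n] by (auto simp: bowen_ball_def bowen_dist_def)

lemma centre_in_bowen_ball: "0 < \<epsilon> \<Longrightarrow> x \<in> bowen_ball act (F n) x \<epsilon>"
  by (simp add: mem_bowen_ball_iff)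

lemma open_bowen_ball: "open (bowen_ball act (F n) x \<epsilon>)"
proof -
  have "bowen_ball act (F n) x \<epsilon> = (\<Inter>g\<in>F n. {y. dist (act g x) (act g y) < \<epsilon>})"
    by (auto simp: mem_bowen_ball_iff)
  moreover have "open {y. dist (act g x) (act g y) < \<epsilon>}" if "g \<in> F n" for g
    using continuous_act[OF that] by (intro open_Collect_less continuous_intros)
  ultimately show ?thesis
    using finite_F by (metis (no_types, lifting) open_INT)
qed

lemma family_union_in_borel: "family_union act F \<epsilon> c \<in> sets borel"
  by (auto simp: family_union_def split: prod.splits intro!: borel_open open_UN open_bowen_ball)

lemma orbit_sum_nonneg: "0 \<le> orbit_sum act \<Phi> A x"
  unfolding orbit_sum_def using potential_pos by (intro sum_nonneg) (simp add: less_imp_le)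

lemma bdd_above_orbit_sum: "bdd_above (orbit_sum act \<Phi> A ` B)"
proof -
  obtain b where "\<And>x. \<Phi> x \<le> b"
    using continuous_attains_sup[OF compact_space _ continuous_potential] by auto
  then have "orbit_sum act \<Phi> A x \<le> real (card A) * b" for x
    unfolding orbit_sum_def by (intro sum_bounded_above) simp
  then show ?thesis
    by (auto simp: bdd_above_def)
qed

lemma centre_weight_antimono:
  assumes "s \<le> t"
  shows "centre_weight act F \<Phi> t c \<le> centre_weight act F \<Phi> s c"
  unfolding centre_weight_def using assms orbit_sum_nonneg
  by (auto intro!: infsum_mono_ennreal ennreal_leI mult_right_mono split: prod.splits)

lemma sup_weight_antimono:
  assumes "s \<le> t" "0 < \<epsilon>"
  shows "sup_weight act F \<Phi> \<epsilon> t c \<le> sup_weight act F \<Phi> \<epsilon> s c"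
proof -
  have "0 \<le> (SUP y\<in>bowen_ball act (F n) x \<epsilon>. orbit_sum act \<Phi> (F n) y)" for n x
    using centre_in_bowen_ball[OF assms(2)] orbit_sum_nonneg bdd_above_orbit_sum
    by (meson cSUP_upper2)
  then show ?thesis
    unfolding sup_weight_def using assms(1)
    by (auto intro!: infsum_mono_ennreal ennreal_leI mult_right_mono split: prod.splits)
qed

lemma sup_weight_antimono_radius:
  assumes "0 < s" "0 < \<epsilon>" "\<epsilon> \<le> \<epsilon>'"
  shows "sup_weight act F \<Phi> \<epsilon>' s c \<le> sup_weight act F \<Phi> \<epsilon> s c"
proof -
  have "(SUP y\<in>bowen_ball act (F n) x \<epsilon>. orbit_sum act \<Phi> (F n) y)
    \<le> (SUP y\<in>bowen_ball act (F n) x \<epsilon>'. orbit_sum act \<Phi> (F n) y)" for n x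
  proof (rule cSUP_subset_mono)
    show "bowen_ball act (F n) x \<epsilon> \<noteq> {}"
      using centre_in_bowen_ball[OF assms(2)] by blast
    show "bowen_ball act (F n) x \<epsilon> \<subseteq> bowen_ball act (F n) x \<epsilon>'"
      using assms(3) by (auto simp: bowen_ball_def)
  qed (auto simp: bdd_above_orbit_sum)
  then show ?thesis
    unfolding sup_weight_def using assms(1)
    by (auto intro!: infsum_mono_ennreal ennreal_leI mult_left_mono split: prod.splits)
qed

lemma sup_weight_le_centre_weight:
  assumes "0 < s" "0 < \<epsilon>"
  shows "sup_weight act F \<Phi> \<epsilon> s c \<le> centre_weight act F \<Phi> s c"
proof -
  have "orbit_sum act \<Phi> (F n) x \<le> (SUP y\<in>bowen_ball act (F n) x \<epsilon>. orbit_sum act \<Phi> (F n) y)" for n x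
    using centre_in_bowen_ball[OF assms(2)] bdd_above_orbit_sum by (intro cSUP_upper)
  then show ?thesis
    unfolding sup_weight_def centre_weight_def using assms(1)
    by (auto intro!: infsum_mono_ennreal ennreal_leI mult_left_mono split: prod.splits)
qed

text \<open>
  The additive error from uniform continuity becomes multiplicative because it can be compared with
  the minimum of the potential, which is attained and positive.
\<close>

lemma uniform_relative_comparison:
  assumes "0 < t" "t < r"
  obtains \<epsilon>\<^sub>0 where "0 < \<epsilon>\<^sub>0" "\<And>u v. dist u v < \<epsilon>\<^sub>0 \<Longrightarrow> t * \<Phi> v \<le> r * \<Phi> u"
proof -
  obtain z where z: "\<And>x. \<Phi> z \<le> \<Phi> x"
    using continuous_attains_inf[OF compact_space _ continuous_potential] by auto
  \<comment> \<open>Chosen so that \<open>t * \<eta> = (r - t) * \<Phi> z \<le> (r - t) * \<Phi> u\<close> for every \<open>u\<close>.\<close>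
  define \<eta> where "\<eta> = (r - t) * \<Phi> z / t"
  have "0 < \<eta>"
    using assms potential_pos by (simp add: \<eta>_def)
  moreover have "uniformly_continuous_on UNIV \<Phi>"
    using continuous_potential compact_space by (rule compact_uniformly_continuous)
  ultimately obtain \<epsilon>\<^sub>0 where \<epsilon>\<^sub>0: "0 < \<epsilon>\<^sub>0" "\<And>u v. dist (v :: 'x) u < \<epsilon>\<^sub>0 \<Longrightarrow> dist (\<Phi> v) (\<Phi> u) < \<eta>"
    unfolding uniformly_continuous_on_def by (metis UNIV_I)
  show ?thesis
  proof
    show "0 < \<epsilon>\<^sub>0" by fact
    fix u v :: 'x assume "dist u v < \<epsilon>\<^sub>0"
    then have "\<Phi> v \<le> \<Phi> u + \<eta>"
      using \<epsilon>\<^sub>0(2)[of v u] by (simp add: dist_commute dist_real_def)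
    then have "t * \<Phi> v \<le> t * \<Phi> u + t * \<eta>"
      using assms(1) by (metis distrib_left mult_left_mono less_imp_le)
    also have "t * \<eta> \<le> (r - t) * \<Phi> u"
      using assms z by (simp add: \<eta>_def)
    finally show "t * \<Phi> v \<le> r * \<Phi> u"
      by (simp add: algebra_simps)
  qed
qed

text \<open>
  A converse to \<open>sup_weight_le_centre_weight\<close> at the price of a slightly larger exponent: the
  pointwise comparison of the potential is summed along the orbit of each point of a Bowen ball. The
  admissible radius depends on the two exponents only, not on the family.
\<close>

lemma centre_weight_le_sup_weight:
  assumes "0 < t" "t < r"
  obtains \<epsilon>\<^sub>0 where "0 < \<epsilon>\<^sub>0"
    and "\<And>\<epsilon> c. 0 < \<epsilon> \<Longrightarrow> \<epsilon> \<le> \<epsilon>\<^sub>0 \<Longrightarrow> centre_weight act F \<Phi> r c \<le> sup_weight act F \<Phi> \<epsilon> t c"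
proof -
  obtain \<epsilon>\<^sub>0 where \<epsilon>\<^sub>0: "0 < \<epsilon>\<^sub>0" "\<And>u v. dist u v < \<epsilon>\<^sub>0 \<Longrightarrow> t * \<Phi> v \<le> r * \<Phi> u"
    using uniform_relative_comparison[OF assms] by metis
  show ?thesis
  proof
    show "0 < \<epsilon>\<^sub>0" by fact
    fix \<epsilon> :: real and c assume \<epsilon>: "0 < \<epsilon>" "\<epsilon> \<le> \<epsilon>\<^sub>0"
    have "t * (SUP y\<in>bowen_ball act (F n) x \<epsilon>. orbit_sum act \<Phi> (F n) y)
      \<le> r * orbit_sum act \<Phi> (F n) x" for n x
    proof -
      have "orbit_sum act \<Phi> (F n) y \<le> r * orbit_sum act \<Phi> (F n) x / t"
        if "y \<in> bowen_ball act (F n) x \<epsilon>" for y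
      proof -
        have "t * orbit_sum act \<Phi> (F n) y \<le> r * orbit_sum act \<Phi> (F n) x"
          unfolding orbit_sum_def sum_distrib_left
          using that \<epsilon> by (intro sum_mono \<epsilon>\<^sub>0(2)) (force simp: mem_bowen_ball_iff)
        then show ?thesis
          using assms(1) by (simp add: field_simps)
      qed
      then have "(SUP y\<in>bowen_ball act (F n) x \<epsilon>. orbit_sum act \<Phi> (F n) y)
        \<le> r * orbit_sum act \<Phi> (F n) x / t"
        using centre_in_bowen_ball[OF \<epsilon>(1)] by (intro cSUP_least) auto
      then show ?thesis
        using assms(1) by (simp add: field_simps)
    qed
    then show "centre_weight act F \<Phi> r c \<le> sup_weight act F \<Phi> \<epsilon> t c"
      unfolding sup_weight_def centre_weight_def
      by (auto intro!: infsum_mono_ennreal ennreal_leI split: prod.splits)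
  qed
qed

section \<open>The dimension of a set through centre weights\<close>

lemma M_crit_antimono:
  assumes "0 < \<epsilon>" "\<epsilon> \<le> \<epsilon>'"
  shows "M_crit act F \<Phi> \<epsilon>' H \<le> M_crit act F \<Phi> \<epsilon> H"
  unfolding M_crit_def
proof (rule critical_value_lim_mono[OF incseq_pre(1) incseq_pre(1)])
  fix s :: real and N assume "0 < s"
  then show "M_pre act F \<Phi> \<epsilon>' H s N \<le> M_pre act F \<Phi> \<epsilon> H s N"
    unfolding M_pre_def using assms family_union_mono[OF assms(2), of act F]
    by (intro INF_superset_mono sup_weight_antimono_radius) blast+
qed

lemma Mt_crit_mono:
  assumes "\<epsilon> \<le> \<epsilon>'" "H \<subseteq> H'"
  shows "Mt_crit act F \<Phi> \<epsilon>' H \<le> Mt_crit act F \<Phi> \<epsilon> H'"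
  unfolding Mt_crit_def
proof (rule critical_value_lim_mono[OF incseq_pre(2) incseq_pre(2)])
  fix s :: real and N
  show "Mt_pre act F \<Phi> \<epsilon>' H s N \<le> Mt_pre act F \<Phi> \<epsilon> H' s N"
    unfolding Mt_pre_def using assms(2) family_union_mono[OF assms(1), of act F]
    by (intro INF_superset_mono) blast+
qed

lemma M_crit_le_Mt_crit:
  assumes "0 < \<epsilon>"
  shows "M_crit act F \<Phi> \<epsilon> H \<le> Mt_crit act F \<Phi> \<epsilon> H"
  unfolding M_crit_def Mt_crit_def
proof (rule critical_value_lim_mono[OF incseq_pre(1) incseq_pre(2)])
  fix s :: real and N assume "0 < s"
  then show "M_pre act F \<Phi> \<epsilon> H s N \<le> Mt_pre act F \<Phi> \<epsilon> H s N"
    unfolding M_pre_def Mt_pre_def using assms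
    by (intro INF_mono) (auto intro: sup_weight_le_centre_weight)
qed

lemma BS_dim_set_eq_SUP: "BS_dim_set act F \<Phi> H = (SUP \<epsilon>\<in>{0<..}. M_crit act F \<Phi> \<epsilon> H)"
  unfolding BS_dim_set_def by (intro Lim_at_right_antimono_eq_SUP M_crit_antimono)

text \<open>
  For reals \<open>r > t\<close> above the dimension, the outer measure with supremum weights vanishes at \<open>t\<close>
  for every radius, hence the one with centre weights vanishes at \<open>r\<close> for every small radius. Since
  \<open>Mt_crit\<close> only grows as the radius shrinks, the bound \<open>r\<close> holds at every radius.
\<close>

lemma Mt_crit_le_BS_dim_set:
  assumes "0 < \<epsilon>"
  shows "Mt_crit act F \<Phi> \<epsilon> H \<le> BS_dim_set act F \<Phi> H"
proof (rule ennreal_le_if_le_reals_above)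
  fix r assume "BS_dim_set act F \<Phi> H < ennreal r"
  then obtain u where u: "BS_dim_set act F \<Phi> H < u" "u < ennreal r"
    using dense by blast
  then obtain t where t: "u = ennreal t" "0 \<le> t"
    by (cases u) auto
  have "t \<noteq> 0"
    using u(1) t(1) by auto
  with t have tr: "0 < t" "t < r"
    using u(2) by (auto simp: ennreal_less_iff)
  obtain \<epsilon>\<^sub>0 where \<epsilon>\<^sub>0: "0 < \<epsilon>\<^sub>0"
    "\<And>\<epsilon> c. 0 < \<epsilon> \<Longrightarrow> \<epsilon> \<le> \<epsilon>\<^sub>0 \<Longrightarrow> centre_weight act F \<Phi> r c \<le> sup_weight act F \<Phi> \<epsilon> t c"
    using centre_weight_le_sup_weight[OF tr] by metis
  define \<epsilon>' where "\<epsilon>' = min \<epsilon> \<epsilon>\<^sub>0"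
  have \<epsilon>': "0 < \<epsilon>'" "\<epsilon>' \<le> \<epsilon>" "\<epsilon>' \<le> \<epsilon>\<^sub>0"
    using assms \<epsilon>\<^sub>0(1) by (auto simp: \<epsilon>'_def)
  have "M_crit act F \<Phi> \<epsilon>' H \<le> BS_dim_set act F \<Phi> H"
    unfolding BS_dim_set_eq_SUP using \<epsilon>'(1) by (intro SUP_upper) simp
  then have less: "critical_value (\<lambda>s. lim (M_pre act F \<Phi> \<epsilon>' H s)) < ennreal t"
    using u(1) t(1) by (simp add: M_crit_def)
  have "M_pre act F \<Phi> \<epsilon>' H b N \<le> M_pre act F \<Phi> \<epsilon>' H a N" if "a \<le> b" for a b N
    unfolding M_pre_def by (intro INF_mono' sup_weight_antimono that \<epsilon>'(1))
  from zero_above_critical_value_lim[OF incseq_pre(1) this less]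
  have zero: "M_pre act F \<Phi> \<epsilon>' H t N = 0" for N .
  have "Mt_pre act F \<Phi> \<epsilon>' H r N \<le> M_pre act F \<Phi> \<epsilon>' H t N" for N
    unfolding M_pre_def Mt_pre_def by (intro INF_mono' \<epsilon>\<^sub>0(2)[OF \<epsilon>'(1,3)])
  then have "Mt_crit act F \<Phi> \<epsilon>' H \<le> ennreal r"
    unfolding Mt_crit_def using tr zero by (intro critical_value_lim_le incseq_pre) auto
  then show "Mt_crit act F \<Phi> \<epsilon> H \<le> ennreal r"
    using Mt_crit_mono[OF \<epsilon>'(2) order_refl] order_trans by blast
qed

lemma BS_dim_set_eq_SUP_Mt_crit:
  "BS_dim_set act F \<Phi> H = (SUP \<epsilon>\<in>{0<..}. Mt_crit act F \<Phi> \<epsilon> H)"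
proof (rule antisym)
  show "BS_dim_set act F \<Phi> H \<le> (SUP \<epsilon>\<in>{0<..}. Mt_crit act F \<Phi> \<epsilon> H)"
    unfolding BS_dim_set_eq_SUP by (intro SUP_mono) (auto intro: M_crit_le_Mt_crit)
  show "(SUP \<epsilon>\<in>{0<..}. Mt_crit act F \<Phi> \<epsilon> H) \<le> BS_dim_set act F \<Phi> H"
    by (intro SUP_least Mt_crit_le_BS_dim_set) simp
qed

end

section \<open>Dimensions of a measure\<close>

locale positive_potential_measure = positive_potential act F \<Phi> + prob_space \<mu>
  for act :: "'g \<Rightarrow> 'x::metric_space \<Rightarrow> 'x" and F \<Phi> and \<mu> :: "'x measure" +
  assumes sets_borel: "sets \<mu> = sets borel"
begin

lemma prob_INT_eq_1:
  fixes A :: "'i::countable \<Rightarrow> 'x set"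
  assumes "\<And>i. A i \<in> sets borel" "\<And>i. prob (A i) = 1"
  shows "prob (\<Inter>i. A i) = 1"
proof -
  have "\<forall>i. AE x in \<mu>. x \<in> A i"
    using assms sets_borel prob_eq_1 by auto
  then have "AE x in \<mu>. x \<in> (\<Inter>i. A i)"
    by (simp add: AE_all_countable)
  then show ?thesis
    using assms(1) sets_borel by (subst prob_eq_1) auto
qed

lemma Katok_crit_antimono:
  assumes "\<epsilon> \<le> \<epsilon>'" "\<delta> \<le> \<delta>'"
  shows "Katok_crit act F \<Phi> \<mu> \<epsilon>' \<delta>' \<le> Katok_crit act F \<Phi> \<mu> \<epsilon> \<delta>"
  unfolding Katok_crit_def
proof (rule critical_value_lim_mono[OF incseq_pre(3) incseq_pre(3)])
  fix s :: real and N
  have "prob (family_union act F \<epsilon> c) \<le> prob (family_union act F \<epsilon>' c)" for c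
    using family_union_in_borel sets_borel
    by (intro finite_measure_mono family_union_mono assms(1)) simp
  then have "1 - \<delta>' < prob (family_union act F \<epsilon>' c)" if "1 - \<delta> < prob (family_union act F \<epsilon> c)" for c
    using that assms(2) by (smt (verit))
  then show "Katok_pre act F \<Phi> \<mu> \<epsilon>' \<delta>' s N \<le> Katok_pre act F \<Phi> \<mu> \<epsilon> \<delta> s N"
    unfolding Katok_pre_def by (intro INF_superset_mono) auto
qed

lemma Katok_dim_measure_eq_SUP:
  "Katok_dim_measure act F \<Phi> \<mu> = (SUP \<epsilon>\<in>{0<..}. SUP \<delta>\<in>{0<..}. Katok_crit act F \<Phi> \<mu> \<epsilon> \<delta>)"
  unfolding Katok_dim_measure_def
  by (subst Lim_at_right_antimono_eq_SUP, intro Katok_crit_antimono, simp_all,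
      subst Lim_at_right_antimono_eq_SUP, auto intro!: SUP_mono' Katok_crit_antimono)

lemma BS_dim_measure_eq_SUP:
  "BS_dim_measure act F \<Phi> \<mu> = (SUP \<epsilon>\<in>{0<..}. SUP \<delta>\<in>{0<..}.
     INF H\<in>{H \<in> sets borel. measure \<mu> H \<ge> 1 - \<delta>}. Mt_crit act F \<Phi> \<epsilon> H)"
  unfolding BS_dim_measure_def
  by (subst Lim_at_right_antimono_eq_SUP, intro INF_superset_mono, force, simp,
      subst Lim_at_right_antimono_eq_SUP,
      auto intro!: SUP_mono' INF_mono' Mt_crit_mono)

lemma Katok_crit_le_Mt_crit:
  assumes "H \<in> sets borel" "1 - \<delta> < prob H"
  shows "Katok_crit act F \<Phi> \<mu> \<epsilon> \<delta> \<le> Mt_crit act F \<Phi> \<epsilon> H"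
  unfolding Katok_crit_def Mt_crit_def
proof (rule critical_value_lim_mono[OF incseq_pre(3) incseq_pre(2)])
  fix s :: real and N
  have "1 - \<delta> < prob (family_union act F \<epsilon> c)" if "H \<subseteq> family_union act F \<epsilon> c" for c
    using that assms family_union_in_borel sets_borel
    by (intro less_le_trans[OF assms(2)] finite_measure_mono) auto
  then show "Katok_pre act F \<Phi> \<mu> \<epsilon> \<delta> s N \<le> Mt_pre act F \<Phi> \<epsilon> H s N"
    unfolding Katok_pre_def Mt_pre_def by (intro INF_superset_mono) auto
qed

text \<open>
  Merge families that miss at most \<open>(1/2)^j\<close> of the measure and have weight less than
  \<open>e * (1/2)^(j+1)\<close>, for \<open>j = 0, 1, \<dots>\<close>; these weights sum to at most \<open>e\<close>.
\<close>

lemma full_measure_family: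
  assumes "\<And>\<delta>. 0 < \<delta> \<Longrightarrow> Katok_pre act F \<Phi> \<mu> \<epsilon> \<delta> s N = 0" and "0 < e"
  obtains c where "c \<in> families_from N" "prob (family_union act F \<epsilon> c) = 1"
    "centre_weight act F \<Phi> s c \<le> ennreal e"
proof -
  have "\<exists>c. c \<in> families_from N \<and> 1 - (1/2)^j < prob (family_union act F \<epsilon> c)
    \<and> centre_weight act F \<Phi> s c < ennreal (e * (1/2)^Suc j)" for j :: nat
  proof -
    have "Katok_pre act F \<Phi> \<mu> \<epsilon> ((1/2)^j) s N < ennreal (e * (1/2)^Suc j)"
      using assms by (simp del: power_Suc)
    then show ?thesis
      unfolding Katok_pre_def INF_less_iff by auto
  qed
  then obtain cs where cs: "\<And>j. cs j \<in> families_from N"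
    "\<And>j. 1 - (1/2)^j < prob (family_union act F \<epsilon> (cs j))"
    "\<And>j. centre_weight act F \<Phi> s (cs j) < ennreal (e * (1/2)^Suc j)"
    by metis
  obtain c where c: "c \<in> families_from N"
    "family_union act F \<epsilon> c = (\<Union>j. family_union act F \<epsilon> (cs j))"
    "centre_weight act F \<Phi> s c \<le> (\<Sum>j. centre_weight act F \<Phi> s (cs j))"
    using combine_ball_families[of cs N act F \<epsilon> \<Phi> s, OF cs(1)] by metis
  show ?thesis
  proof
    show "c \<in> families_from N" by fact
    have le: "1 - (1/2)^j \<le> prob (family_union act F \<epsilon> c)" for j
      using cs(2)[of j] c(2) family_union_in_borel sets_borel
      by (intro order_trans[OF less_imp_le finite_measure_mono]) auto
    have "(\<lambda>j. 1 - (1/2::real)^j) \<longlonglongrightarrow> 1 - 0"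
      by (intro tendsto_intros LIMSEQ_power_zero) simp
    then have "1 \<le> prob (family_union act F \<epsilon> c)"
      using le by (auto intro: LIMSEQ_le_const2)
    then show "prob (family_union act F \<epsilon> c) = 1"
      using prob_le_1 by (simp add: antisym)
    have "(\<Sum>j. centre_weight act F \<Phi> s (cs j)) \<le> (\<Sum>j. ennreal (e * (1/2)^Suc j))"
      using cs(3) by (intro suminf_le) (auto simp: less_imp_le)
    also have "\<dots> = ennreal e"
      using sums_mult[OF power_half_series, of e] assms(2)
      by (intro suminf_ennreal_eq) auto
    finally show "centre_weight act F \<Phi> s c \<le> ennreal e"
      using c(3) by (rule order_trans[rotated])
  qed
qed

text \<open>
  The set is the intersection of the unions of full measure families \<open>c N k\<close> that start at \<open>N\<close> and
  have weight at most \<open>1 / (k + 1)\<close>: for each \<open>N\<close> it is covered by families of arbitrarily small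
  weight.
\<close>

lemma full_measure_set:
  assumes "(SUP \<delta>\<in>{0<..}. Katok_crit act F \<Phi> \<mu> \<epsilon> \<delta>) < ennreal s"
  obtains H where "H \<in> sets borel" "prob H = 1" "Mt_crit act F \<Phi> \<epsilon> H \<le> ennreal s"
proof -
  have "0 < ennreal s"
    using assms by (rule le_less_trans[rotated]) simp
  then have "0 < s"
    by simp
  have zero: "Katok_pre act F \<Phi> \<mu> \<epsilon> \<delta> s N = 0" if "0 < \<delta>" for \<delta> N
  proof (rule zero_above_critical_value_lim[of "Katok_pre act F \<Phi> \<mu> \<epsilon> \<delta>"])
    show "Katok_pre act F \<Phi> \<mu> \<epsilon> \<delta> b N \<le> Katok_pre act F \<Phi> \<mu> \<epsilon> \<delta> a N" if "a \<le> b" for a b N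
      unfolding Katok_pre_def by (intro INF_mono' centre_weight_antimono that)
    have "Katok_crit act F \<Phi> \<mu> \<epsilon> \<delta> \<le> (SUP \<delta>\<in>{0<..}. Katok_crit act F \<Phi> \<mu> \<epsilon> \<delta>)"
      using that by (intro SUP_upper) simp
    then show "critical_value (\<lambda>s. lim (Katok_pre act F \<Phi> \<mu> \<epsilon> \<delta> s)) < ennreal s"
      using assms by (simp add: Katok_crit_def)
  qed (rule incseq_pre)
  have "\<exists>c. c \<in> families_from N \<and> prob (family_union act F \<epsilon> c) = 1
    \<and> centre_weight act F \<Phi> s c \<le> ennreal (inverse (real (Suc k)))" for N k
    using full_measure_family[OF zero, where e = "inverse (real (Suc k))"]
    by (metis inverse_positive_iff_positive of_nat_0_less_iff zero_less_Suc)
  then obtain c where c: "\<And>N k. c N k \<in> families_from N"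
    "\<And>N k. prob (family_union act F \<epsilon> (c N k)) = 1"
    "\<And>N k. centre_weight act F \<Phi> s (c N k) \<le> ennreal (inverse (real (Suc k)))"
    by metis
  define H where "H = (\<Inter>(N, k). family_union act F \<epsilon> (c N k))"
  show ?thesis
  proof
    show "H \<in> sets borel"
      unfolding H_def by (intro sets.countable_INT'') (auto simp: family_union_in_borel)
    show "prob H = 1"
      unfolding H_def by (rule prob_INT_eq_1) (auto simp: family_union_in_borel c(2))
    have "Mt_pre act F \<Phi> \<epsilon> H s N = 0" for N
    proof -
      have le: "Mt_pre act F \<Phi> \<epsilon> H s N \<le> ennreal (inverse (real (Suc k)))" for k
        unfolding Mt_pre_def using c by (intro INF_lower2[of "c N k"]) (auto simp: H_def)
      have "(\<lambda>k. ennreal (inverse (real (Suc k)))) \<longlonglongrightarrow> ennreal 0"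
        by (intro tendsto_ennrealI LIMSEQ_inverse_real_of_nat)
      then have "Mt_pre act F \<Phi> \<epsilon> H s N \<le> ennreal 0"
        using le by (intro LIMSEQ_le_const) auto
      then show ?thesis
        by simp
    qed
    then show "Mt_crit act F \<Phi> \<epsilon> H \<le> ennreal s"
      unfolding Mt_crit_def using \<open>0 < s\<close> by (intro critical_value_lim_le incseq_pre)
  qed
qed

lemma BS_dim_measure_eq_Katok_dim_measure:
  "BS_dim_measure act F \<Phi> \<mu> = Katok_dim_measure act F \<Phi> \<mu>"
  unfolding BS_dim_measure_eq_SUP Katok_dim_measure_eq_SUP
proof (rule SUP_cong[OF refl], rule antisym)
  fix \<epsilon> :: real
  let ?A = "\<lambda>\<delta>. INF H\<in>{H \<in> sets borel. prob H \<ge> 1 - \<delta>}. Mt_crit act F \<Phi> \<epsilon> H"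
  let ?K = "\<lambda>\<delta>. Katok_crit act F \<Phi> \<mu> \<epsilon> \<delta>"
  show "(SUP \<delta>\<in>{0<..}. ?K \<delta>) \<le> (SUP \<delta>\<in>{0<..}. ?A \<delta>)"
  proof (rule SUP_mono)
    fix \<delta> :: real assume "\<delta> \<in> {0<..}"
    \<comment> \<open>Halving turns \<open>prob H \<ge> 1 - \<delta> / 2\<close> into the strict inequality required of Katok families.\<close>
    then have "?K \<delta> \<le> ?A (\<delta> / 2)"
      by (intro INF_greatest Katok_crit_le_Mt_crit) auto
    then show "\<exists>\<delta>'\<in>{0<..}. ?K \<delta> \<le> ?A \<delta>'"
      using \<open>\<delta> \<in> {0<..}\<close> by (intro bexI[of _ "\<delta> / 2"]) auto
  qed
  show "(SUP \<delta>\<in>{0<..}. ?A \<delta>) \<le> (SUP \<delta>\<in>{0<..}. ?K \<delta>)"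
  proof (rule ennreal_le_if_le_reals_above, rule SUP_least)
    fix s \<delta> :: real assume s: "(SUP \<delta>\<in>{0<..}. ?K \<delta>) < ennreal s" and "\<delta> \<in> {0<..}"
    obtain H where "H \<in> sets borel" "prob H = 1" "Mt_crit act F \<Phi> \<epsilon> H \<le> ennreal s"
      using full_measure_set[OF s] by metis
    then show "?A \<delta> \<le> ennreal s"
      using \<open>\<delta> \<in> {0<..}\<close> by (intro INF_lower2[of H]) auto
  qed
qed

text \<open>
  For the upper bound, one set of full measure has to be good for all radii at once; since the
  critical value is monotone in the radius and in the set, the intersection of the sets belonging to
  the radii \<open>1 / (k + 1)\<close> is.
\<close>

lemma Katok_dim_measure_eq_INF:
  "Katok_dim_measure act F \<Phi> \<mu>
    = (INF H\<in>{H \<in> sets borel. measure \<mu> H = 1}. BS_dim_set act F \<Phi> H)"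
proof (rule antisym)
  show "Katok_dim_measure act F \<Phi> \<mu>
    \<le> (INF H\<in>{H \<in> sets borel. measure \<mu> H = 1}. BS_dim_set act F \<Phi> H)"
    unfolding BS_dim_set_eq_SUP_Mt_crit Katok_dim_measure_eq_SUP
  proof (rule INF_greatest, rule SUP_mono)
    fix H and \<epsilon> :: real assume "H \<in> {H \<in> sets borel. prob H = 1}" "\<epsilon> \<in> {0<..}"
    then have "(SUP \<delta>\<in>{0<..}. Katok_crit act F \<Phi> \<mu> \<epsilon> \<delta>) \<le> Mt_crit act F \<Phi> \<epsilon> H"
      by (intro SUP_least Katok_crit_le_Mt_crit) auto
    with \<open>\<epsilon> \<in> {0<..}\<close>
    show "\<exists>\<epsilon>'\<in>{0<..}. (SUP \<delta>\<in>{0<..}. Katok_crit act F \<Phi> \<mu> \<epsilon> \<delta>) \<le> Mt_crit act F \<Phi> \<epsilon>' H"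
      by blast
  qed
  show "(INF H\<in>{H \<in> sets borel. measure \<mu> H = 1}. BS_dim_set act F \<Phi> H)
    \<le> Katok_dim_measure act F \<Phi> \<mu>"
  proof (rule ennreal_le_if_le_reals_above)
    fix s assume s: "Katok_dim_measure act F \<Phi> \<mu> < ennreal s"
    have "(SUP \<delta>\<in>{0<..}. Katok_crit act F \<Phi> \<mu> (1 / (real k + 1)) \<delta>) < ennreal s" for k
      using s unfolding Katok_dim_measure_eq_SUP
      by (rule le_less_trans[rotated]) (intro SUP_upper, simp)
    then have "\<exists>H. H \<in> sets borel \<and> prob H = 1
      \<and> Mt_crit act F \<Phi> (1 / (real k + 1)) H \<le> ennreal s" for k
      using full_measure_set by metis
    then obtain H where H: "\<And>k. H k \<in> sets borel" "\<And>k. prob (H k) = 1"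
      "\<And>k. Mt_crit act F \<Phi> (1 / (real k + 1)) (H k) \<le> ennreal s"
      by metis
    have "Mt_crit act F \<Phi> (1 / (real k + 1)) (\<Inter>k. H k) \<le> ennreal s" for k
      by (rule order_trans[OF Mt_crit_mono H(3)]) auto
    then have "BS_dim_set act F \<Phi> (\<Inter>k. H k) \<le> ennreal s"
      unfolding BS_dim_set_eq_SUP_Mt_crit
      by (intro SUP_positive_cofinal Mt_crit_mono) auto
    moreover have "(\<Inter>k. H k) \<in> sets borel" "prob (\<Inter>k. H k) = 1"
      using H prob_INT_eq_1[of H] by auto
    ultimately show "(INF H\<in>{H \<in> sets borel. measure \<mu> H = 1}. BS_dim_set act F \<Phi> H) \<le> ennreal s"
      by (intro INF_lower2[of "\<Inter>k. H k"]) auto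
  qed
qed

end

theorem theorem1p2:
  fixes G :: "('g, 'm) monoid_scheme"
    and act :: "'g \<Rightarrow> 'x::metric_space \<Rightarrow> 'x"
    and F :: "nat \<Rightarrow> 'g set"
    and \<Phi> :: "'x \<Rightarrow> real"
    and \<mu> :: "'x measure"
  assumes "group G" and "countable (carrier G)" and "infinite (carrier G)" and "amenable_group G"
    and "compact (UNIV :: 'x set)"
    and "group_action G (UNIV :: 'x set) act"
    and "\<forall>g\<in>carrier G. continuous_on UNIV (act g)"
    and "folner_sequence G F"
    and "mono (\<lambda>n. card (F n))"
    and "filterlim (\<lambda>n. card (F n)) at_top sequentially"
    and "continuous_on UNIV \<Phi>" and "\<forall>x. \<Phi> x > 0"
    and "prob_space \<mu>" and "sets \<mu> = sets borel"
  shows "BS_dim_measure act F \<Phi> \<mu> = Katok_dim_measure act F \<Phi> \<mu> \<and>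
    Katok_dim_measure act F \<Phi> \<mu> =
      (INF H\<in>{H \<in> sets borel. measure \<mu> H = 1}. BS_dim_set act F \<Phi> H)"
proof -
  have F: "finite (F n)" "F n \<noteq> {}" "F n \<subseteq> carrier G" for n
    using \<open>folner_sequence G F\<close> by (simp_all add: folner_sequence_def)
  have potential: "positive_potential act F \<Phi>"
  proof
    show "continuous_on UNIV (act g)" if "g \<in> F n" for n g
      using that F(3) assms(7) by blast
    show "0 < \<Phi> x" for x
      using assms(12) by (rule spec)
  qed (fact F(1) F(2) assms(5,11))+
  interpret positive_potential_measure act F \<Phi> \<mu>
    by (intro positive_potential_measure.intro positive_potential_measure_axioms.intro
        potential assms(13,14))
  show ?thesis
    using BS_dim_measure_eq_Katok_dim_measure Katok_dim_measure_eq_INF by (rule conjI)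
qed

end
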